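(* Let $A\in\mathbb{R}^{n\times n}$, $B\in\mathbb{R}^{n\times m}$, $D\in\mathbb{R}^{n\times r}$ be such that $(A,B)$ and $(A,D)$ are controllable, and let $P_d\in\mathbb{S}_{++}^n$. Consider the optimization problem $$\min_{P}\ d_{\mathrm{BW}}^2(P,P_d)\quad\text{s.t.}\quad P\in\mathbb{S}_{++}^n,\quad (I_n-BB^\dagger)\left(AP+PA^\top+DD^\top\right)(I_n-BB^\dagger)=O_n .$$ This is a convex optimization problem with a strictly convex objective function: its feasible set is convex and the objective $P\mapsto d_{\mathrm{BW}}^2(P,P_d)$ is strictly convex on $\mathbb{S}_{++}^n$. Hence, if an optimal solution exists, it is unique.
   Context: $\mathbb{S}_{+}^n$ and $\mathbb{S}_{++}^n$ denote the sets of real symmetric $n\times n$ positive semidefinite and positive definite matrices, respectively. $B^\dagger$ is the Moore--Penrose pseudoinverse of $B$, $I_n$ the identity matrix and $O_n$ the $n\times n$ zero matrix. For $X,Y\in\mathbb{S}_+^n$, the Bures--Wasserstein distance is $$d_{\mathrm{BW}}(X,Y)=\left(\mathrm{tr}\left(X+Y-2\left(Y^{1/2}XY^{1/2}\right)^{1/2}\right)\right)^{1/2},$$ where $M^{1/2}$ denotes the unique positive semidefinite square root of $M\in\mathbb{S}_+^n$. *)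

theory Defs
  imports "HOL-Analysis.Analysis"
begin

text \<open>
  An \<open>n \<times> m\<close> real matrix has type \<open>real ^ 'm ^ 'n\<close>, with row index type \<open>'n\<close> and column
  index type \<open>'m\<close>.
\<close>

definition psd_matrices :: "(real ^ 'n ^ 'n) set" where
  "psd_matrices = {M. transpose M = M \<and> (\<forall>x. 0 \<le> x \<bullet> (M *v x))}"

definition pd_matrices :: "(real ^ 'n ^ 'n) set" where
  "pd_matrices = {M. transpose M = M \<and> (\<forall>x. x \<noteq> 0 \<longrightarrow> 0 < x \<bullet> (M *v x))}"

definition psd_sqrt :: "real ^ 'n ^ 'n \<Rightarrow> real ^ 'n ^ 'n" where
  "psd_sqrt M = (THE S. S \<in> psd_matrices \<and> S ** S = M)"

text \<open>The Moore--Penrose pseudoinverse, as the unique solution of the four Penrose equations.\<close>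

definition pinv :: "real ^ 'm ^ 'n \<Rightarrow> real ^ 'n ^ 'm" where
  "pinv B = (THE X. B ** X ** B = B \<and> X ** B ** X = X \<and>
     transpose (B ** X) = B ** X \<and> transpose (X ** B) = X ** B)"

text \<open>
  Controllability of the pair \<open>(A, B)\<close>: in the system \<open>x' = A x + B u\<close> every state can be steered
  to every other state in finite time. For linear time-invariant systems it is immaterial whether
  the inputs are required to be continuous, piecewise continuous or merely locally integrable.
\<close>

definition controllable :: "real ^ 'n ^ 'n \<Rightarrow> real ^ 'm ^ 'n \<Rightarrow> bool" where
  "controllable A B \<longleftrightarrow>
     (\<forall>x0 x1. \<exists>T>0. \<exists>(u :: real \<Rightarrow> real ^ 'm) (x :: real \<Rightarrow> real ^ 'n).
        continuous_on {0..T} u \<and>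
        (\<forall>t\<in>{0..T}. (x has_vector_derivative (A *v x t + B *v u t)) (at t within {0..T})) \<and>
        x 0 = x0 \<and> x T = x1)"

definition bw_dist :: "real ^ 'n ^ 'n \<Rightarrow> real ^ 'n ^ 'n \<Rightarrow> real" where
  "bw_dist X Y =
     sqrt (trace (X + Y - 2 *\<^sub>R psd_sqrt (psd_sqrt Y ** X ** psd_sqrt Y)))"

definition feasible_set ::
  "real ^ 'n ^ 'n \<Rightarrow> real ^ 'm ^ 'n \<Rightarrow> real ^ 'r ^ 'n \<Rightarrow> (real ^ 'n ^ 'n) set" where
  "feasible_set A B D = {P \<in> pd_matrices.
     (mat 1 - B ** pinv B) ** (A ** P + P ** transpose A + D ** transpose D)
       ** (mat 1 - B ** pinv B) = 0}"

definition strictly_convex_on :: "'a::real_vector set \<Rightarrow> ('a \<Rightarrow> real) \<Rightarrow> bool" where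
  "strictly_convex_on S f \<longleftrightarrow> convex S \<and>
     (\<forall>x\<in>S. \<forall>y\<in>S. x \<noteq> y \<longrightarrow>
        (\<forall>u>0. \<forall>v>0. u + v = 1 \<longrightarrow> f (u *\<^sub>R x + v *\<^sub>R y) < u * f x + v * f y))"

end

theory Submission
  imports Defs
begin

text \<open>
  Expanding the square root in the definition of the distance gives, for positive definite \<open>P\<close>
  and \<open>Z\<close> and \<open>Q = Z\<^sup>1\<^sup>/\<^sup>2\<close>,
  \<open>d(P, Z)\<^sup>2 = tr P + tr Z - 2 tr (Q P Q)\<^sup>1\<^sup>/\<^sup>2\<close>.
  The first two terms are affine in \<open>P\<close> and \<open>P \<mapsto> Q P Q\<close> is linear and injective, so
  strict convexity of the objective is strict concavity of \<open>M \<mapsto> tr M\<^sup>1\<^sup>/\<^sup>2\<close>.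

  The latter follows from a variational formula. For positive definite \<open>M\<close> and \<open>T\<close>, with
  \<open>S = M\<^sup>1\<^sup>/\<^sup>2\<close>, the completed square
  \<open>tr (M T\<^sup>-\<^sup>1) + tr T - 2 tr S = tr ((S - T) T\<^sup>-\<^sup>1 (S - T))\<close>
  (\<open>trace_sqrt_gap\<close>) is nonnegative and vanishes only for \<open>T = S\<close>. Hence \<open>2 tr M\<^sup>1\<^sup>/\<^sup>2\<close> is
  the minimum over \<open>T\<close> of functions affine in \<open>M\<close>, and the minimiser \<open>T\<close> determines
  \<open>M = T\<^sup>2\<close>. A minimum of affine functions is concave, and as two different matrices never
  share a minimiser, it is strictly concave (\<open>trace_sqrt_strictly_concave\<close>). The choice
  \<open>T = Z\<close> in the same formula shows that the radicand in the distance is nonnegative, so that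
  squaring the distance does recover the trace (\<open>bw_dist_squared\<close>).

  All this presupposes that a positive definite matrix has exactly one positive semidefinite
  square root. Existence comes without diagonalisation: after scaling, \<open>M = I - A\<close> for a
  symmetric strict contraction \<open>A\<close>, and \<open>I - Y\<close> is a root as soon as
  \<open>Y = (A + Y\<^sup>2) / 2\<close>, an equation to which Banach's fixed point theorem applies
  (\<open>one_minus_contraction_root_exists\<close>, \<open>pd_matrix_root_exists\<close>).

  Finally, the constraint is an affine equation in \<open>P\<close>, so the feasible set is convex; and the
  midpoint of two different minimisers of a strictly convex function would do better than both.
\<close>

section \<open>Linearity of matrix operations\<close>

lemma bounded_bilinear_matrix_mult:
  "bounded_bilinear ((**) :: real^'m^'n \<Rightarrow> real^'k^'m \<Rightarrow> real^'k^'n)"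
proof -
  have add: "(A + B) ** C = A ** C + B ** C" for A B :: "real^'m^'n" and C :: "real^'k^'m"
    by (simp add: matrix_matrix_mult_def vec_eq_iff distrib_right sum.distrib)
  have "bilinear ((**) :: real^'m^'n \<Rightarrow> real^'k^'m \<Rightarrow> real^'k^'n)"
    unfolding bilinear_def
    by (auto intro!: linearI simp: add matrix_add_ldistrib matrix_scalar_ac scalar_matrix_assoc)
  thus ?thesis
    by (simp add: bilinear_conv_bounded_bilinear)
qed

interpretation matrix_mult: bounded_bilinear "(**) :: real^'m^'n \<Rightarrow> real^'k^'m \<Rightarrow> real^'k^'n"
  by (rule bounded_bilinear_matrix_mult)

lemmas matrix_mult_linear_simps =
  matrix_mult.add_left matrix_mult.add_right matrix_mult.diff_left matrix_mult.diff_right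
  matrix_mult.scaleR_left matrix_mult.scaleR_right

lemma linear_transpose: "linear (transpose :: real^'m^'n \<Rightarrow> real^'n^'m)"
  by (auto intro!: linearI simp: transpose_def vec_eq_iff)

lemmas transpose_add = linear_add[OF linear_transpose]
lemmas transpose_diff = linear_diff[OF linear_transpose]

lemma linear_trace: "linear (trace :: real^'n^'n \<Rightarrow> real)"
  by (auto intro!: linearI simp: trace_def sum.distrib sum_distrib_left)

lemmas trace_scaleR = linear_scale[OF linear_trace]

section \<open>Positive definite matrices\<close>

lemma symmetric_inner:
  fixes M :: "real^'n^'n"
  assumes "transpose M = M"
  shows "(M *v x) \<bullet> y = x \<bullet> (M *v y)"
  by (metis assms dot_lmul_matrix vector_transpose_matrix)

lemma pd_matrices_subset_psd: "(pd_matrices :: (real^'n^'n) set) \<subseteq> psd_matrices"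
proof
  fix M :: "real^'n^'n"
  assume M: "M \<in> pd_matrices"
  have "0 \<le> x \<bullet> (M *v x)" for x
    using M by (cases "x = 0") (auto simp: pd_matrices_def less_imp_le)
  thus "M \<in> psd_matrices"
    using M by (simp add: psd_matrices_def pd_matrices_def)
qed

lemma pd_matrices_convex_combination:
  fixes X Y :: "real^'n^'n"
  assumes "X \<in> pd_matrices" "Y \<in> pd_matrices" "0 \<le> u" "0 \<le> v" "u + v = 1"
  shows "u *\<^sub>R X + v *\<^sub>R Y \<in> pd_matrices"
proof -
  have "0 < x \<bullet> ((u *\<^sub>R X + v *\<^sub>R Y) *v x)" if "x \<noteq> 0" for x
  proof -
    have pos: "0 < x \<bullet> (X *v x)" "0 < x \<bullet> (Y *v x)"
      using assms that by (auto simp: pd_matrices_def)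
    have "x \<bullet> ((u *\<^sub>R X + v *\<^sub>R Y) *v x) = u * (x \<bullet> (X *v x)) + v * (x \<bullet> (Y *v x))"
      by (simp add: matrix_vector_mult_add_rdistrib inner_add_right
          flip: scaleR_matrix_vector_assoc)
    also have "\<dots> > 0"
    proof (cases "u = 0")
      case True
      thus ?thesis using assms pos by simp
    next
      case False
      thus ?thesis using assms pos by (intro add_pos_nonneg mult_pos_pos mult_nonneg_nonneg) auto
    qed
    finally show ?thesis .
  qed
  thus ?thesis
    using assms by (simp add: pd_matrices_def transpose_add transpose_scalar)
qed

lemma convex_pd_matrices: "convex (pd_matrices :: (real^'n^'n) set)"
  by (auto intro!: convexI pd_matrices_convex_combination)

lemma pd_matrices_kernel:
  fixes M :: "real^'n^'n"
  assumes "M \<in> pd_matrices" "M *v x = 0"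
  shows "x = 0"
  using assms by (force simp: pd_matrices_def)

text \<open>
  A semidefinite form that vanishes at \<open>x\<close> has a minimum there, so its derivative \<open>2 M x\<close>
  vanishes as well; injectivity then leaves only \<open>x = 0\<close>.
\<close>

lemma psd_matrix_injective_imp_pd:
  fixes M :: "real^'n^'n"
  assumes M: "M \<in> psd_matrices" and inj: "\<And>x. M *v x = 0 \<Longrightarrow> x = 0"
  shows "M \<in> pd_matrices"
proof -
  have sym: "transpose M = M" and nonneg: "\<And>x. 0 \<le> x \<bullet> (M *v x)"
    using M by (auto simp: psd_matrices_def)
  have "M *v x = 0" if x: "x \<bullet> (M *v x) = 0" for x
  proof -
    let ?y = "M *v x"
    let ?a = "?y \<bullet> ?y" and ?b = "?y \<bullet> (M *v ?y)"
    \<comment> \<open>The form along the line through \<open>x\<close> in the direction of its gradient: without constant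
      term, it can be nonnegative on both sides of \<open>0\<close> only if the linear coefficient is \<open>0\<close>.\<close>
    have quad: "0 \<le> 2 * t * ?a + t * t * ?b" for t
    proof -
      have "(x + t *\<^sub>R ?y) \<bullet> (M *v (x + t *\<^sub>R ?y)) = 2 * t * ?a + t * t * ?b"
        using x symmetric_inner[OF sym, of x ?y]
        by (simp add: matrix_vector_right_distrib matrix_vector_mult_scaleR inner_add_left
            inner_add_right algebra_simps)
      thus ?thesis using nonneg[of "x + t *\<^sub>R ?y"] by simp
    qed
    have "?a = 0"
    proof (rule ccontr)
      assume "?a \<noteq> 0"
      hence a: "0 < ?a" by simp
      have b: "0 \<le> ?b" by (rule nonneg)
      \<comment> \<open>The minimiser would be \<open>- ?a / ?b\<close>; adding \<open>1\<close> avoids dividing by \<open>0\<close>.\<close>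
      let ?t = "- ?a / (?b + 1)"
      have "2 * ?t * ?a + ?t * ?t * ?b = - (?a * ?a * (?b + 2)) / ((?b + 1) * (?b + 1))"
        using b by (simp add: divide_simps) (simp add: algebra_simps)
      also have "\<dots> < 0"
        using a b by (simp add: divide_neg_pos)
      finally show False using quad[of ?t] by linarith
    qed
    thus ?thesis by simp
  qed
  hence "x \<bullet> (M *v x) \<noteq> 0" if "x \<noteq> 0" for x
    using inj that by blast
  thus ?thesis
    using sym nonneg by (auto simp: pd_matrices_def order_less_le)
qed

lemma psd_root_of_pd_is_pd:
  fixes M :: "real^'n^'n"
  assumes "S \<in> psd_matrices" "S ** S = M" "M \<in> pd_matrices"
  shows "S \<in> pd_matrices"
  using assms(1)
proof (rule psd_matrix_injective_imp_pd)
  fix x assume "S *v x = 0"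
  hence "M *v x = 0"
    by (simp add: assms(2)[symmetric] flip: matrix_vector_mul_assoc)
  thus "x = 0" by (rule pd_matrices_kernel[OF assms(3)])
qed

lemma pd_matrices_congruence:
  fixes Q X :: "real^'n^'n"
  assumes "Q \<in> pd_matrices" "X \<in> pd_matrices"
  shows "Q ** X ** Q \<in> pd_matrices"
proof -
  have sym: "transpose Q = Q" "transpose X = X"
    using assms by (auto simp: pd_matrices_def)
  have "0 < x \<bullet> ((Q ** X ** Q) *v x)" if "x \<noteq> 0" for x
  proof -
    have "Q *v x \<noteq> 0"
      using pd_matrices_kernel[OF assms(1)] that by blast
    moreover have "x \<bullet> ((Q ** X ** Q) *v x) = (Q *v x) \<bullet> (X *v (Q *v x))"
      by (simp add: symmetric_inner[OF sym(1)] flip: matrix_vector_mul_assoc)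
    ultimately show ?thesis
      using assms(2) by (simp add: pd_matrices_def)
  qed
  thus ?thesis
    by (simp add: pd_matrices_def matrix_transpose_mul sym matrix_mul_assoc)
qed

lemma pd_matrix_inverse:
  fixes T :: "real^'n^'n"
  assumes T: "T \<in> pd_matrices"
  obtains W where "W \<in> pd_matrices" "W ** T = mat 1" "T ** W = mat 1"
proof -
  have sym: "transpose T = T" using T by (simp add: pd_matrices_def)
  obtain W where WT: "W ** T = mat 1"
    using pd_matrices_kernel[OF T] matrix_left_invertible_ker[of T] by blast
  hence TW: "T ** W = mat 1" by (simp add: matrix_left_right_inverse)
  have tW: "transpose W = W"
  proof -
    have "transpose W = transpose W ** (T ** W)" by (simp add: TW)
    also have "\<dots> = transpose (T ** W) ** W"
      by (simp add: matrix_transpose_mul sym matrix_mul_assoc)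
    finally show ?thesis by (simp add: TW)
  qed
  have "0 < x \<bullet> (W *v x)" if "x \<noteq> 0" for x
  proof -
    have x: "T *v (W *v x) = x" by (simp add: matrix_vector_mul_assoc TW)
    hence "W *v x \<noteq> 0" using that by auto
    hence "0 < (W *v x) \<bullet> (T *v (W *v x))" using T by (simp add: pd_matrices_def)
    thus ?thesis by (simp add: x inner_commute)
  qed
  hence "W \<in> pd_matrices" using tW by (simp add: pd_matrices_def)
  thus thesis using WT TW by (rule that)
qed

section \<open>Traces of congruences\<close>

text \<open>
  The trace of a congruence is the sum of the values of the quadratic form at the columns, so it
  inherits the sign of the form. This is the only way in which definiteness is turned into trace
  inequalities below.
\<close>

lemma trace_congruence:
  fixes W :: "real^'n^'n" and E :: "real^'m^'n"
  shows "trace (transpose E ** W ** E) = (\<Sum>j\<in>UNIV. column j E \<bullet> (W *v column j E))"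
proof -
  have "(transpose E ** W ** E) $ j $ j = column j E \<bullet> (W *v column j E)" for j
  proof -
    have "(transpose E ** W ** E) $ j $ j = axis j 1 \<bullet> ((transpose E ** W ** E) *v axis j 1)"
      by (simp add: matrix_vector_mult_basis inner_axis' column_def)
    also have "\<dots> = (E *v axis j 1) \<bullet> (W *v (E *v axis j 1))"
      by (metis dot_lmul_matrix inner_commute matrix_vector_mul_assoc transpose_matrix_vector)
    finally show ?thesis by (simp add: matrix_vector_mult_basis)
  qed
  thus ?thesis by (simp add: trace_def)
qed

lemma trace_congruence_nonneg:
  fixes W E :: "real^'n^'n"
  assumes "W \<in> psd_matrices" "transpose E = E"
  shows "0 \<le> trace (E ** W ** E)"
  using trace_congruence[of E W] assms by (simp add: psd_matrices_def sum_nonneg)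

lemma trace_congruence_eq_0:
  fixes W E :: "real^'n^'n"
  assumes W: "W \<in> pd_matrices" and E: "transpose E = E" and tr: "trace (E ** W ** E) = 0"
  shows "E = 0"
proof -
  have "(\<Sum>j\<in>UNIV. column j E \<bullet> (W *v column j E)) = 0"
    using trace_congruence[of E W] E tr by simp
  moreover have "0 \<le> column j E \<bullet> (W *v column j E)" for j
    using W pd_matrices_subset_psd by (auto simp: psd_matrices_def)
  ultimately have zero: "column j E \<bullet> (W *v column j E) = 0" for j
    by (simp add: sum_nonneg_eq_0_iff)
  have "column j E = 0" for j
  proof (rule ccontr)
    assume "column j E \<noteq> 0"
    hence "0 < column j E \<bullet> (W *v column j E)"
      using W by (simp add: pd_matrices_def)
    thus False using zero[of j] by simp
  qed
  thus ?thesis by (simp add: column_def vec_eq_iff)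
qed

section \<open>Existence and uniqueness of square roots\<close>

lemma norm_matrix_columns:
  fixes A :: "real^'m^'n"
  shows "(norm A)\<^sup>2 = (\<Sum>j\<in>UNIV. (norm (column j A))\<^sup>2)"
proof -
  have "(norm A)\<^sup>2 = (\<Sum>i\<in>UNIV. \<Sum>j\<in>UNIV. A $ i $ j * A $ i $ j)"
    by (simp add: power2_norm_eq_inner inner_vec_def)
  also have "\<dots> = (\<Sum>j\<in>UNIV. \<Sum>i\<in>UNIV. A $ i $ j * A $ i $ j)"
    by (rule sum.swap)
  finally show ?thesis
    by (simp add: power2_norm_eq_inner inner_vec_def column_def)
qed

lemma norm_transpose:
  fixes A :: "real^'m^'n"
  shows "norm (transpose A) = norm A"
proof -
  have "(norm (transpose A))\<^sup>2 = (norm A)\<^sup>2"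
    unfolding norm_matrix_columns[of "transpose A"]
    by (simp add: power2_norm_eq_inner inner_vec_def row_def)
  thus ?thesis by simp
qed

text \<open>
  The norm of a matrix is the Frobenius norm, while \<open>r\<close> bounds the operator norm of the left
  factor. Applying \<open>A\<close> to each column of \<open>B\<close> gives the mixed estimate, which is sharper than
  submultiplicativity of the Frobenius norm: contractions in the operator norm may well have a
  large Frobenius norm.
\<close>

lemma norm_matrix_mult_le:
  fixes A :: "real^'m^'n" and B :: "real^'k^'m"
  assumes A: "\<And>x. norm (A *v x) \<le> r * norm x" and r: "0 \<le> r"
  shows "norm (A ** B) \<le> r * norm B"
proof (rule power2_le_imp_le)
  have "(norm (A ** B))\<^sup>2 = (\<Sum>j\<in>UNIV. (norm (A *v column j B))\<^sup>2)"
    unfolding norm_matrix_columns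
    by (simp flip: matrix_vector_mult_basis add: matrix_vector_mul_assoc)
  also have "\<dots> \<le> (\<Sum>j\<in>UNIV. (r * norm (column j B))\<^sup>2)"
    by (intro sum_mono power_mono A) auto
  also have "\<dots> = (r * norm B)\<^sup>2"
    by (simp add: power_mult_distrib norm_matrix_columns[of B] sum_distrib_left)
  finally show "(norm (A ** B))\<^sup>2 \<le> (r * norm B)\<^sup>2" .
qed (use r in auto)

text \<open>
  Expanding \<open>(I - Y)\<^sup>2 = I - A\<close> gives the fixed point equation \<open>Y = (A + Y\<^sup>2) / 2\<close>. Its right
  hand side maps the symmetric matrices of operator norm at most \<open>a\<close> to themselves because
  \<open>(a + a\<^sup>2) / 2 \<le> a\<close>, and it contracts by the factor \<open>a\<close> there because
  \<open>Y\<^sup>2 - Z\<^sup>2 = Y (Y - Z) + (Y - Z) Z\<close>. Contraction is measured in the Frobenius norm, the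
  metric of the matrix type, and the constraint in the operator norm;
  \<open>norm_matrix_mult_le\<close> lets them work together.
\<close>

lemma one_minus_contraction_root_exists:
  fixes A :: "real^'n^'n"
  assumes symA: "transpose A = A"
    and A: "\<And>x. norm (A *v x) \<le> a * norm x" and a: "0 \<le> a" "a < 1"
  obtains Y where "transpose Y = Y" "\<And>x. norm (Y *v x) \<le> a * norm x"
    "(mat 1 - Y) ** (mat 1 - Y) = mat 1 - A"
proof -
  define \<S> :: "(real^'n^'n) set"
    where "\<S> = {Y. transpose Y = Y} \<inter> {Y. \<forall>x. norm (Y *v x) \<le> a * norm x}"
  define f :: "real^'n^'n \<Rightarrow> real^'n^'n" where "f Y = (1/2) *\<^sub>R (A + Y ** Y)" for Y
  have "linear (\<lambda>Y :: real^'n^'n. Y *v x)" for x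
    by (auto intro!: linearI simp: matrix_vector_mult_add_rdistrib
        simp flip: scaleR_matrix_vector_assoc)
  hence "continuous_on UNIV (\<lambda>Y :: real^'n^'n. Y *v x)" for x
    by (simp add: linear_continuous_on linear_conv_bounded_linear)
  hence "closed {Y :: real^'n^'n. \<forall>x. norm (Y *v x) \<le> a * norm x}"
    by (intro closed_Collect_all closed_Collect_le continuous_on_norm continuous_on_const)
  moreover have "subspace {Y :: real^'n^'n. transpose Y = Y}"
    by (simp add: subspace_def transpose_add transpose_scalar linear_0[OF linear_transpose])
  ultimately have "complete \<S>"
    unfolding \<S>_def complete_eq_closed by (simp add: closed_Int closed_subspace)
  moreover have "0 \<in> \<S>"
    using a by (simp add: \<S>_def linear_0[OF linear_transpose])
  moreover have "f ` \<S> \<subseteq> \<S>"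
  proof
    fix Z assume "Z \<in> f ` \<S>"
    then obtain Y where Z: "Z = f Y" and Y: "transpose Y = Y" "\<And>x. norm (Y *v x) \<le> a * norm x"
      by (auto simp: \<S>_def)
    have "norm (f Y *v x) \<le> a * norm x" for x
    proof -
      have "norm (Y *v (Y *v x)) \<le> a * (a * norm x)"
        using Y(2)[of "Y *v x"] mult_left_mono[OF Y(2)[of x] a(1)] by linarith
      also have "\<dots> \<le> 1 * (a * norm x)"
        using a by (intro mult_right_mono) auto
      finally have *: "norm (Y *v (Y *v x)) \<le> a * norm x" by simp
      have "f Y *v x = (1/2) *\<^sub>R (A *v x + Y *v (Y *v x))"
        by (simp add: f_def matrix_vector_mult_add_rdistrib matrix_vector_mul_assoc
            flip: scaleR_matrix_vector_assoc)
      hence "norm (f Y *v x) = (1/2) * norm (A *v x + Y *v (Y *v x))"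
        by simp
      also have "\<dots> \<le> (1/2) * (a * norm x + a * norm x)"
        using norm_triangle_mono[OF A[of x] *] by (intro mult_left_mono) auto
      finally show ?thesis by simp
    qed
    thus "Z \<in> \<S>"
      by (simp add: \<S>_def Z f_def[of Y] transpose_add transpose_scalar matrix_transpose_mul symA Y)
  qed
  moreover have "dist (f Y) (f Z) \<le> a * dist Y Z" if "Y \<in> \<S>" "Z \<in> \<S>" for Y Z
  proof -
    have Y: "transpose Y = Y" "\<And>x. norm (Y *v x) \<le> a * norm x"
      and Z: "transpose Z = Z" "\<And>x. norm (Z *v x) \<le> a * norm x"
      using that by (auto simp: \<S>_def)
    \<comment> \<open>Transposition moves the contraction \<open>Z\<close> to the left, where the mixed estimate applies.\<close>
    have "norm ((Y - Z) ** Z) = norm (Z ** (Y - Z))"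
      using norm_transpose[of "(Y - Z) ** Z"]
      by (simp add: matrix_transpose_mul transpose_diff Y Z)
    hence right: "norm ((Y - Z) ** Z) \<le> a * norm (Y - Z)"
      using norm_matrix_mult_le[OF Z(2) a(1)] by simp
    have left: "norm (Y ** (Y - Z)) \<le> a * norm (Y - Z)"
      by (rule norm_matrix_mult_le[OF Y(2) a(1)])
    have "f Y - f Z = (1/2) *\<^sub>R (Y ** (Y - Z) + (Y - Z) ** Z)"
      by (simp add: f_def matrix_mult_linear_simps algebra_simps)
    hence "norm (f Y - f Z) = (1/2) * norm (Y ** (Y - Z) + (Y - Z) ** Z)"
      by simp
    also have "\<dots> \<le> (1/2) * (a * norm (Y - Z) + a * norm (Y - Z))"
      using norm_triangle_mono[OF left right] by (intro mult_left_mono) auto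
    finally show ?thesis by (simp add: dist_norm)
  qed
  ultimately have "\<exists>!Y. Y \<in> \<S> \<and> f Y = Y"
    by (intro Banach_fix[OF _ _ a]) auto
  then obtain Y where Y: "Y \<in> \<S>" "f Y = Y" by blast
  have "A + Y ** Y = 2 *\<^sub>R f Y" by (simp add: f_def)
  hence "A = 2 *\<^sub>R Y - Y ** Y" by (simp add: Y(2) algebra_simps)
  hence "(mat 1 - Y) ** (mat 1 - Y) = mat 1 - A"
    by (simp add: matrix_mult_linear_simps algebra_simps scaleR_2)
  with Y(1) that show thesis by (auto simp: \<S>_def)
qed

text \<open>
  The constant is the minimum of the form on the compact unit sphere; homogeneity does the rest.
\<close>

lemma pd_matrix_coercive:
  fixes M :: "real^'n^'n"
  assumes M: "M \<in> pd_matrices"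
  obtains m where "0 < m" "\<And>x. m * (norm x)\<^sup>2 \<le> x \<bullet> (M *v x)"
proof -
  let ?S = "sphere 0 1 :: (real^'n) set"
  have "\<exists>x\<in>?S. \<forall>y\<in>?S. x \<bullet> (M *v x) \<le> y \<bullet> (M *v y)"
  proof (rule continuous_attains_inf)
    show "continuous_on ?S (\<lambda>x. x \<bullet> (M *v x))"
      by (intro continuous_intros linear_continuous_on matrix_vector_mul_bounded_linear)
  qed auto
  then obtain x0 where x0: "norm x0 = 1" "\<And>y. norm y = 1 \<Longrightarrow> x0 \<bullet> (M *v x0) \<le> y \<bullet> (M *v y)"
    by auto
  have "x0 \<bullet> (M *v x0) * (norm x)\<^sup>2 \<le> x \<bullet> (M *v x)" for x
  proof (cases "x = 0")
    case False
    let ?y = "x /\<^sub>R norm x"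
    have "x0 \<bullet> (M *v x0) \<le> ?y \<bullet> (M *v ?y)"
      using False by (intro x0) simp
    also have "\<dots> = (x \<bullet> (M *v x)) / (norm x)\<^sup>2"
      by (simp add: matrix_vector_mult_scaleR power2_eq_square divide_inverse)
    finally show ?thesis using False by (simp add: pos_le_divide_eq)
  qed simp
  moreover have "0 < x0 \<bullet> (M *v x0)"
  proof -
    have "x0 \<noteq> 0" using x0(1) by auto
    thus ?thesis using M by (simp add: pd_matrices_def)
  qed
  ultimately show thesis using that by blast
qed

text \<open>
  To turn \<open>I - c M\<close> into a contraction, expand
  \<open>|x - c M x|\<^sup>2 \<le> (1 - 2 c m + c\<^sup>2 K\<^sup>2) |x|\<^sup>2\<close>, where \<open>m\<close> is a lower bound of the form and
  \<open>K\<close> an upper bound of the operator norm. The factor is smallest for \<open>c = m / K\<^sup>2\<close>, where it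
  equals \<open>1 - m\<^sup>2 / K\<^sup>2 < 1\<close>.
\<close>

lemma pd_matrix_root_exists:
  fixes M :: "real^'n^'n"
  assumes M: "M \<in> pd_matrices"
  obtains S where "S \<in> psd_matrices" "S ** S = M"
proof -
  have symM: "transpose M = M" using M by (simp add: pd_matrices_def)
  obtain m where m: "0 < m" "\<And>x. m * (norm x)\<^sup>2 \<le> x \<bullet> (M *v x)"
    using pd_matrix_coercive[OF M] by blast
  obtain K where K: "0 < K" "\<And>x. norm (M *v x) \<le> norm x * K"
    using bounded_linear.pos_bounded[OF matrix_vector_mul_bounded_linear[of M]] by blast
  define c where "c = m / K\<^sup>2"
  \<comment> \<open>The maximum spares the proof that \<open>m \<le> K\<close> before the square root is taken.\<close>
  define q where "q = max 0 (1 - m\<^sup>2 / K\<^sup>2)"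
  define a where "a = sqrt q"
  define A where "A = mat 1 - c *\<^sub>R M"
  have c: "0 < c" using m K by (simp add: c_def)
  have q: "0 \<le> q" "q < 1" using m K by (auto simp: q_def)
  have a: "0 \<le> a" "a < 1" using q by (auto simp: a_def)
  have symA: "transpose A = A"
    by (simp add: A_def transpose_diff transpose_scalar symM)
  have A: "norm (A *v x) \<le> a * norm x" for x
  proof (rule power2_le_imp_le)
    have Ax: "A *v x = x - c *\<^sub>R (M *v x)"
      by (simp add: A_def matrix_vector_mult_diff_rdistrib scaleR_matrix_vector_assoc)
    have "(norm (A *v x))\<^sup>2 = (norm x)\<^sup>2 - 2 * c * (x \<bullet> (M *v x)) + c\<^sup>2 * (norm (M *v x))\<^sup>2"
      unfolding Ax power2_norm_eq_inner
      by (simp add: inner_diff_left inner_diff_right inner_commute power2_eq_square algebra_simps)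
    also have "\<dots> \<le> (norm x)\<^sup>2 - 2 * c * (m * (norm x)\<^sup>2) + c\<^sup>2 * (norm x * K)\<^sup>2"
      using c m(2)[of x] K(2)[of x]
      by (intro add_mono diff_mono mult_left_mono power_mono) auto
    also have "\<dots> = (1 - m\<^sup>2 / K\<^sup>2) * (norm x)\<^sup>2"
      using K by (simp add: c_def power_mult_distrib power2_eq_square field_simps)
    also have "\<dots> \<le> q * (norm x)\<^sup>2"
      by (intro mult_right_mono) (auto simp: q_def)
    finally show "(norm (A *v x))\<^sup>2 \<le> (a * norm x)\<^sup>2"
      using q by (simp add: a_def power_mult_distrib)
  qed (use a in auto)
  obtain Y where Y: "transpose Y = Y" "\<And>x. norm (Y *v x) \<le> a * norm x"
    "(mat 1 - Y) ** (mat 1 - Y) = mat 1 - A"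
    using one_minus_contraction_root_exists[OF symA A a] by blast
  define S where "S = (1 / sqrt c) *\<^sub>R (mat 1 - Y)"
  have "0 \<le> x \<bullet> (S *v x)" for x
  proof -
    have "x \<bullet> (Y *v x) \<le> norm x * norm (Y *v x)" by (rule norm_cauchy_schwarz)
    also have "\<dots> \<le> norm x * (1 * norm x)"
      using Y(2)[of x] a by (intro mult_left_mono order_trans[OF Y(2)] mult_right_mono) auto
    also have "\<dots> = x \<bullet> x" by (simp add: power2_norm_eq_inner flip: power2_eq_square)
    finally have "0 \<le> x \<bullet> x - x \<bullet> (Y *v x)" by simp
    moreover have "x \<bullet> (S *v x) = (1 / sqrt c) * (x \<bullet> x - x \<bullet> (Y *v x))"
      by (simp add: S_def matrix_vector_mult_diff_rdistrib inner_diff_right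
          flip: scaleR_matrix_vector_assoc)
    ultimately show ?thesis using c by simp
  qed
  hence "S \<in> psd_matrices"
    by (simp add: psd_matrices_def S_def transpose_scalar transpose_diff Y)
  moreover have "S ** S = M"
    using c Y(3) by (simp add: S_def A_def matrix_mult.scaleR_left matrix_mult.scaleR_right)
  ultimately show thesis by (rule that)
qed

text \<open>
  For \<open>D = S - T\<close> the equation \<open>S\<^sup>2 = T\<^sup>2\<close> becomes \<open>S D + D T = 0\<close>. Multiplying by \<open>D\<close> and
  taking traces writes \<open>0\<close> as the sum of the nonnegative numbers \<open>tr (D S D)\<close> and
  \<open>tr (D T D)\<close>, and the first one vanishes only for \<open>D = 0\<close>.
\<close>

lemma psd_root_unique:
  fixes S T :: "real^'n^'n"
  assumes S: "S \<in> pd_matrices" and T: "T \<in> psd_matrices" and eq: "S ** S = T ** T"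
  shows "S = T"
proof -
  let ?D = "S - T"
  have sym: "transpose ?D = ?D"
    using S T by (simp add: pd_matrices_def psd_matrices_def transpose_diff)
  have "S ** ?D + ?D ** T = 0"
    by (simp add: matrix_mult_linear_simps eq)
  hence "trace (?D ** (S ** ?D + ?D ** T)) = 0"
    by (simp add: linear_0[OF linear_trace])
  moreover have "trace (?D ** (S ** ?D + ?D ** T)) = trace (?D ** S ** ?D) + trace (?D ** T ** ?D)"
    using trace_mul_sym[of ?D "?D ** T"]
    by (simp only: matrix_add_ldistrib trace_add matrix_mul_assoc)
  moreover have "0 \<le> trace (?D ** S ** ?D)" "0 \<le> trace (?D ** T ** ?D)"
    using S T sym pd_matrices_subset_psd by (auto intro!: trace_congruence_nonneg)
  ultimately have "trace (?D ** S ** ?D) = 0" by linarith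
  hence "?D = 0" by (rule trace_congruence_eq_0[OF S sym])
  thus ?thesis by simp
qed

lemma psd_sqrt_pd:
  fixes M :: "real^'n^'n"
  assumes M: "M \<in> pd_matrices"
  shows "psd_sqrt M \<in> pd_matrices" and "psd_sqrt M ** psd_sqrt M = M"
proof -
  obtain S where S: "S \<in> psd_matrices" "S ** S = M"
    using pd_matrix_root_exists[OF M] .
  have pd: "S \<in> pd_matrices" by (rule psd_root_of_pd_is_pd[OF S M])
  have "psd_sqrt M = S"
    unfolding psd_sqrt_def
  proof (rule the_equality)
    show "S \<in> psd_matrices \<and> S ** S = M" using S by blast
    fix T assume "T \<in> psd_matrices \<and> T ** T = M"
    thus "T = S" using psd_root_unique[OF pd, of T] S(2) by simp
  qed
  with S pd show "psd_sqrt M \<in> pd_matrices" "psd_sqrt M ** psd_sqrt M = M" by auto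
qed

section \<open>Strict concavity of the trace of the square root\<close>

text \<open>
  Expanding the right hand side, the mixed terms collapse to \<open>S\<close> since \<open>W\<close> is the inverse of
  \<open>T\<close>, and cyclicity turns \<open>tr (S W S)\<close> into \<open>tr (M W)\<close>.
\<close>

lemma trace_sqrt_gap:
  fixes M T W :: "real^'n^'n"
  assumes M: "M \<in> pd_matrices" and WT: "W ** T = mat 1" and TW: "T ** W = mat 1"
  shows "trace (M ** W) + trace T - 2 * trace (psd_sqrt M)
    = trace ((psd_sqrt M - T) ** W ** (psd_sqrt M - T))"
proof -
  let ?S = "psd_sqrt M"
  have "trace (?S ** W ** ?S) = trace (M ** W)"
    using trace_mul_sym[of "?S ** W" ?S] by (simp only: matrix_mul_assoc psd_sqrt_pd(2)[OF M])
  moreover have "(?S - T) ** W ** (?S - T) = ?S ** W ** ?S - ?S - ?S + T"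
  proof -
    have "?S ** W ** T = ?S" "T ** W ** ?S = ?S" "T ** W ** T = T"
      by (simp_all add: TW WT flip: matrix_mul_assoc[of ?S])
    thus ?thesis by (simp add: matrix_mult_linear_simps)
  qed
  ultimately show ?thesis by (simp only: trace_add trace_sub)
qed

lemma trace_sqrt_le:
  fixes M T W :: "real^'n^'n"
  assumes "M \<in> pd_matrices" "T \<in> pd_matrices" "W \<in> pd_matrices" "W ** T = mat 1" "T ** W = mat 1"
  shows "2 * trace (psd_sqrt M) \<le> trace (M ** W) + trace T"
proof -
  have "transpose (psd_sqrt M - T) = psd_sqrt M - T"
    using psd_sqrt_pd(1)[OF assms(1)] assms(2) by (simp add: pd_matrices_def transpose_diff)
  thus ?thesis
    using trace_sqrt_gap[OF assms(1,4,5)] trace_congruence_nonneg[of W "psd_sqrt M - T"]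
      assms(3) pd_matrices_subset_psd by auto
qed

lemma trace_sqrt_eq_imp:
  fixes M T W :: "real^'n^'n"
  assumes "M \<in> pd_matrices" "T \<in> pd_matrices" "W \<in> pd_matrices" "W ** T = mat 1" "T ** W = mat 1"
    and eq: "2 * trace (psd_sqrt M) = trace (M ** W) + trace T"
  shows "M = T ** T"
proof -
  have "transpose (psd_sqrt M - T) = psd_sqrt M - T"
    using psd_sqrt_pd(1)[OF assms(1)] assms(2) by (simp add: pd_matrices_def transpose_diff)
  hence "psd_sqrt M - T = 0"
    using trace_sqrt_gap[OF assms(1,4,5)] eq by (intro trace_congruence_eq_0[OF assms(3)]) auto
  thus ?thesis using psd_sqrt_pd(2)[OF assms(1)] by simp
qed

text \<open>
  The gap between \<open>tr (Z T\<^sup>-\<^sup>1) + tr T\<close> and \<open>2 tr Z\<^sup>1\<^sup>/\<^sup>2\<close> is taken at the matrix \<open>T\<close> that is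
  optimal for the convex combination. It is \<open>0\<close> at the combination and nonnegative at \<open>X\<close> and
  \<open>Y\<close>. If it were \<open>0\<close> at both, then \<open>X = T\<^sup>2 = Y\<close>.
\<close>

lemma trace_sqrt_strictly_concave:
  fixes X Y :: "real^'n^'n"
  assumes X: "X \<in> pd_matrices" and Y: "Y \<in> pd_matrices" and "X \<noteq> Y"
    and uv: "0 < u" "0 < v" "u + v = 1"
  shows "u * trace (psd_sqrt X) + v * trace (psd_sqrt Y) < trace (psd_sqrt (u *\<^sub>R X + v *\<^sub>R Y))"
proof -
  let ?M = "u *\<^sub>R X + v *\<^sub>R Y"
  let ?T = "psd_sqrt ?M"
  have M: "?M \<in> pd_matrices"
    using X Y uv by (intro pd_matrices_convex_combination) auto
  note T = psd_sqrt_pd[OF M]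
  obtain W where W: "W \<in> pd_matrices" "W ** ?T = mat 1" "?T ** W = mat 1"
    using pd_matrix_inverse[OF T(1)] .
  define gap where "gap Z = trace (Z ** W) + trace ?T - 2 * trace (psd_sqrt Z)" for Z
  have nonneg: "0 \<le> gap X" "0 \<le> gap Y"
    using trace_sqrt_le[OF X T(1) W] trace_sqrt_le[OF Y T(1) W] by (auto simp: gap_def)
  have "gap X \<noteq> 0 \<or> gap Y \<noteq> 0"
    using trace_sqrt_eq_imp[OF X T(1) W] trace_sqrt_eq_imp[OF Y T(1) W] \<open>X \<noteq> Y\<close>
    by (force simp: gap_def)
  hence "0 < u * gap X + v * gap Y"
    using nonneg uv
    by (metis add_nonneg_pos add_pos_nonneg less_eq_real_def mult_nonneg_nonneg mult_pos_pos)
  moreover have "gap ?M = 0"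
    using trace_sqrt_gap[OF M W(2,3)] by (simp add: gap_def linear_0[OF linear_trace])
  moreover have "gap ?M = u * (trace (X ** W) + trace ?T) + v * (trace (Y ** W) + trace ?T)
      - 2 * trace ?T"
  proof -
    have "trace ?T = u * trace ?T + v * trace ?T"
      using uv(3) by (metis distrib_right mult_1)
    thus ?thesis
      by (simp add: gap_def matrix_mult_linear_simps trace_add trace_scaleR algebra_simps)
  qed
  ultimately show ?thesis by (simp add: gap_def algebra_simps)
qed

section \<open>The squared Bures--Wasserstein distance\<close>

text \<open>
  The real square root of a negative number is negative, so squaring it gives the absolute value;
  the formula needs the trace in the definition of the distance to be nonnegative. The variational
  bound for \<open>Q X Q\<close> with \<open>T = Y = Q\<^sup>2\<close> gives just that, as \<open>tr (Q X Q Y\<^sup>-\<^sup>1) = tr X\<close>.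
\<close>

lemma bw_dist_squared:
  fixes X Y :: "real^'n^'n"
  assumes X: "X \<in> pd_matrices" and Y: "Y \<in> pd_matrices"
  shows "(bw_dist X Y)\<^sup>2
    = trace X + trace Y - 2 * trace (psd_sqrt (psd_sqrt Y ** X ** psd_sqrt Y))"
proof -
  let ?Q = "psd_sqrt Y"
  note Q = psd_sqrt_pd[OF Y]
  obtain W where W: "W \<in> pd_matrices" "W ** Y = mat 1" "Y ** W = mat 1"
    using pd_matrix_inverse[OF Y] .
  have "?Q ** W ** ?Q = mat 1"
  proof -
    have "?Q ** (?Q ** W) = mat 1" by (simp add: matrix_mul_assoc Q W)
    thus ?thesis by (simp add: matrix_left_right_inverse)
  qed
  moreover have "trace (?Q ** X ** ?Q ** W) = trace (X ** (?Q ** W ** ?Q))"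
    using trace_mul_sym[of ?Q "X ** ?Q ** W"] by (simp only: matrix_mul_assoc)
  ultimately have "trace (?Q ** X ** ?Q ** W) = trace X" by simp
  hence "2 * trace (psd_sqrt (?Q ** X ** ?Q)) \<le> trace X + trace Y"
    using trace_sqrt_le[OF pd_matrices_congruence[OF Q(1) X] Y W] by simp
  thus ?thesis
    by (simp add: bw_dist_def trace_add trace_sub trace_scaleR)
qed

lemma strictly_convex_bw_dist_squared:
  fixes Z :: "real^'n^'n"
  assumes Z: "Z \<in> pd_matrices"
  shows "strictly_convex_on pd_matrices (\<lambda>P. (bw_dist P Z)\<^sup>2)"
  unfolding strictly_convex_on_def
proof (intro conjI ballI allI impI convex_pd_matrices)
  fix X Y :: "real^'n^'n" and u v :: real
  assume X: "X \<in> pd_matrices" and Y: "Y \<in> pd_matrices" and "X \<noteq> Y"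
    and uv: "0 < u" "0 < v" "u + v = 1"
  let ?Q = "psd_sqrt Z"
  let ?g = "\<lambda>P. ?Q ** P ** ?Q"
  have Q: "?Q \<in> pd_matrices" by (rule psd_sqrt_pd[OF Z])
  obtain W where W: "W ** ?Q = mat 1" "?Q ** W = mat 1"
    using pd_matrix_inverse[OF Q] by blast
  have "W ** ?g P ** W = P" for P
  proof -
    have "W ** ?g P ** W = (W ** ?Q) ** P ** (?Q ** W)"
      by (simp only: matrix_mul_assoc)
    thus ?thesis by (simp add: W)
  qed
  hence "?g X \<noteq> ?g Y" using \<open>X \<noteq> Y\<close> by metis
  hence concave: "u * trace (psd_sqrt (?g X)) + v * trace (psd_sqrt (?g Y))
      < trace (psd_sqrt (u *\<^sub>R ?g X + v *\<^sub>R ?g Y))"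
    using X Y Q uv by (intro trace_sqrt_strictly_concave pd_matrices_congruence)
  have "?g (u *\<^sub>R X + v *\<^sub>R Y) = u *\<^sub>R ?g X + v *\<^sub>R ?g Y"
    by (simp add: matrix_mult_linear_simps)
  moreover have "u *\<^sub>R X + v *\<^sub>R Y \<in> pd_matrices"
    using X Y uv by (intro pd_matrices_convex_combination) auto
  moreover have "trace Z = u * trace Z + v * trace Z"
    using uv(3) by (metis distrib_right mult_1)
  ultimately show "(bw_dist (u *\<^sub>R X + v *\<^sub>R Y) Z)\<^sup>2
      < u * (bw_dist X Z)\<^sup>2 + v * (bw_dist Y Z)\<^sup>2"
    using concave
    by (simp add: bw_dist_squared X Y Z trace_add trace_scaleR algebra_simps)
qed

section \<open>The optimization problem\<close>

lemma convex_feasible_set: "convex (feasible_set A B D)"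
proof (rule convexI)
  fix X Y and u v :: real
  assume X: "X \<in> feasible_set A B D" and Y: "Y \<in> feasible_set A B D"
    and uv: "0 \<le> u" "0 \<le> v" "u + v = 1"
  let ?N = "mat 1 - B ** pinv B"
  let ?L = "\<lambda>P. A ** P + P ** transpose A + D ** transpose D"
  let ?C = "D ** transpose D"
  \<comment> \<open>Splitting the constant term by \<open>u + v = 1\<close> makes the affine map commute with the combination.\<close>
  have "?C = u *\<^sub>R ?C + v *\<^sub>R ?C"
    by (metis uv(3) scaleR_left_distrib scaleR_one)
  hence "?L (u *\<^sub>R X + v *\<^sub>R Y) = u *\<^sub>R ?L X + v *\<^sub>R ?L Y"
    by (simp add: matrix_mult_linear_simps algebra_simps)
  hence "?N ** ?L (u *\<^sub>R X + v *\<^sub>R Y) ** ?N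
      = u *\<^sub>R (?N ** ?L X ** ?N) + v *\<^sub>R (?N ** ?L Y ** ?N)"
    by (simp only: matrix_mult.add_left matrix_mult.add_right matrix_mult.scaleR_left
        matrix_mult.scaleR_right)
  moreover have "?N ** ?L X ** ?N = 0" "?N ** ?L Y ** ?N = 0"
    using X Y by (auto simp: feasible_set_def)
  ultimately show "u *\<^sub>R X + v *\<^sub>R Y \<in> feasible_set A B D"
    using X Y uv by (auto simp: feasible_set_def pd_matrices_convex_combination)
qed

lemma strictly_convex_arg_min_unique:
  assumes f: "strictly_convex_on S f" and C: "convex C" "C \<subseteq> S"
    and x: "is_arg_min f (\<lambda>z. z \<in> C) x" and y: "is_arg_min f (\<lambda>z. z \<in> C) y"
  shows "x = y"
proof (rule ccontr)
  assume "x \<noteq> y"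
  let ?z = "(1/2) *\<^sub>R x + (1/2) *\<^sub>R y"
  have xy: "x \<in> C" "y \<in> C" and min: "\<And>z. z \<in> C \<Longrightarrow> f x \<le> f z" "f y \<le> f x"
    using x y by (auto simp: is_arg_min_linorder)
  have "f ?z < (1/2) * f x + (1/2) * f y"
    using f \<open>x \<noteq> y\<close> xy C(2) unfolding strictly_convex_on_def
    by (meson field_sum_of_halves half_gt_zero_iff subsetD zero_less_one)
  moreover have "?z \<in> C" using convexD[OF C(1) xy] by simp
  ultimately show False using min by fastforce
qed

theorem theorem2:
  fixes A :: "real ^ 'n ^ 'n" and B :: "real ^ 'm ^ 'n" and D :: "real ^ 'r ^ 'n"
    and P\<^sub>d :: "real ^ 'n ^ 'n"
  assumes "controllable A B"
    and "controllable A D"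
    and "P\<^sub>d \<in> pd_matrices"
  shows "convex (feasible_set A B D)
    \<and> strictly_convex_on pd_matrices (\<lambda>P. (bw_dist P P\<^sub>d)\<^sup>2)
    \<and> ((\<exists>P. is_arg_min (\<lambda>P. (bw_dist P P\<^sub>d)\<^sup>2) (\<lambda>P. P \<in> feasible_set A B D) P)
        \<longrightarrow> (\<exists>!P. is_arg_min (\<lambda>P. (bw_dist P P\<^sub>d)\<^sup>2) (\<lambda>P. P \<in> feasible_set A B D) P))"
proof -
  have strict: "strictly_convex_on pd_matrices (\<lambda>P. (bw_dist P P\<^sub>d)\<^sup>2)"
    by (rule strictly_convex_bw_dist_squared[OF assms(3)])
  have "feasible_set A B D \<subseteq> pd_matrices"
    by (auto simp: feasible_set_def)
  from strictly_convex_arg_min_unique[OF strict convex_feasible_set this]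
  show ?thesis
    using strict convex_feasible_set by blast
qed

end
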